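(* Let $R$ be a commutative ring, $n\ge2$, and let $\varphi$ be a $2n\times2n$ alternating matrix over $R$ with Pfaffian $1$. Then ${\rm E}_{2n-1}(R)={\rm E}_\varphi(R)$.
   Context: ${\rm E}_m(R)$ is the subgroup of ${\rm SL}_m(R)$ generated by elementary matrices $I_m+\lambda e_{ij}$ ($i\neq j$, $\lambda\in R$). A square matrix is alternating if it is of the form $\nu-\nu^t$; alternating matrices of Pfaffian $1$ are invertible. Elements of $R^m$ are row vectors, ${}^t$ is transpose. For an invertible alternating $2n\times2n$ matrix $\varphi$ write $\varphi=\begin{pmatrix}0&-c\\ c^t&\nu\end{pmatrix}$, $\varphi^{-1}=\begin{pmatrix}0&d\\ -d^t&\mu\end{pmatrix}$ with $c,d\in R^{2n-1}$, and set $\alpha_\varphi(v)=I_{2n-1}+d^tv\nu$, $\beta_\varphi(v)=I_{2n-1}+\mu v^tc$; ${\rm E}_\varphi(R)$ is the subgroup of ${\rm GL}_{2n-1}(R)$ generated by all $\alpha_\varphi(v),\beta_\varphi(v)$, $v\in R^{2n-1}$. *)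

theory Defs
  imports "Jordan_Normal_Form.Determinant"
begin

(* Subgroup of GL_m(R) generated by a set S of m x m matrices:
   smallest set containing the identity and S, closed under products and inverses
   (inverses of invertible members; in a commutative ring a one-sided inverse
   of a square matrix is two-sided). *)
inductive_set gen_subgroup :: "nat \<Rightarrow> 'a::comm_ring_1 mat set \<Rightarrow> 'a mat set"
  for m :: nat and S :: "'a mat set" where
  gen_one: "1\<^sub>m m \<in> gen_subgroup m S"
| gen_gen: "A \<in> S \<Longrightarrow> A \<in> carrier_mat m m \<Longrightarrow> A \<in> gen_subgroup m S"
| gen_mult: "A \<in> gen_subgroup m S \<Longrightarrow> B \<in> gen_subgroup m S \<Longrightarrow> A * B \<in> gen_subgroup m S"
| gen_inv: "A \<in> gen_subgroup m S \<Longrightarrow> B \<in> carrier_mat m m \<Longrightarrow> A * B = 1\<^sub>m m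
            \<Longrightarrow> B \<in> gen_subgroup m S"

definition elem_mat :: "nat \<Rightarrow> nat \<Rightarrow> nat \<Rightarrow> 'a::comm_ring_1 \<Rightarrow> 'a mat" where
  "elem_mat m i j c = mat m m (\<lambda>(k,l). (if k = l then 1 else 0) + (if k = i \<and> l = j then c else 0))"

definition E_group :: "nat \<Rightarrow> 'a::comm_ring_1 mat set" where
  "E_group m = gen_subgroup m {elem_mat m i j c | i j c. i < m \<and> j < m \<and> i \<noteq> j}"

definition alternating :: "'a::comm_ring_1 mat \<Rightarrow> bool" where
  "alternating A \<longleftrightarrow> (\<exists>\<nu> \<in> carrier_mat (dim_row A) (dim_row A). A = \<nu> - transpose_mat \<nu>)"

(* Pfaffian of a 2n x 2n matrix, via perfect matchings (division-free):
   sum over permutations s of {0..2n-1} with s(2i) < s(2i+1) and s(0) < s(2) < ... < s(2n-2)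
   of sign(s) * prod_i A(s(2i), s(2i+1)). *)
definition pfaffian :: "'a::comm_ring_1 mat \<Rightarrow> 'a" where
  "pfaffian A = (let n = dim_row A div 2 in
     \<Sum>s \<in> {s. s permutes {..<2*n} \<and> (\<forall>i<n. s (2*i) < s (2*i+1))
                 \<and> (\<forall>i. Suc i < n \<longrightarrow> s (2*i) < s (2*i+2))}.
       signof s * (\<Prod>i<n. A $$ (s (2*i), s (2*i+1))))"

definition mat_inverse :: "'a::comm_ring_1 mat \<Rightarrow> 'a mat" where
  "mat_inverse A = (THE B. B \<in> carrier_mat (dim_row A) (dim_row A) \<and> A * B = 1\<^sub>m (dim_row A))"

(* block data: phi = [[0, -c],[c^t, nu]], phi^{-1} = [[0, d],[-d^t, mu]] *)
definition blk_c :: "'a::comm_ring_1 mat \<Rightarrow> 'a vec" where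
  "blk_c A = vec (dim_row A - 1) (\<lambda>j. - (A $$ (0, j+1)))"
definition blk_lr :: "'a::comm_ring_1 mat \<Rightarrow> 'a mat" where
  "blk_lr A = mat (dim_row A - 1) (dim_row A - 1) (\<lambda>(i,j). A $$ (i+1, j+1))"
definition blk_d :: "'a::comm_ring_1 mat \<Rightarrow> 'a vec" where
  "blk_d A = vec (dim_row A - 1) (\<lambda>j. A $$ (0, j+1))"

definition alpha_phi :: "'a::comm_ring_1 mat \<Rightarrow> 'a vec \<Rightarrow> 'a mat" where
  "alpha_phi \<phi> v = (let m = dim_row \<phi> - 1 in
     1\<^sub>m m + mat_of_cols m [blk_d (mat_inverse \<phi>)] * mat_of_rows m [v] * blk_lr \<phi>)"
definition beta_phi :: "'a::comm_ring_1 mat \<Rightarrow> 'a vec \<Rightarrow> 'a mat" where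
  "beta_phi \<phi> v = (let m = dim_row \<phi> - 1 in
     1\<^sub>m m + blk_lr (mat_inverse \<phi>) * mat_of_cols m [v] * mat_of_rows m [blk_c \<phi>])"

definition E_phi :: "'a::comm_ring_1 mat \<Rightarrow> 'a mat set" where
  "E_phi \<phi> = (let m = dim_row \<phi> - 1 in
     gen_subgroup m ({alpha_phi \<phi> v | v. v \<in> carrier_vec m} \<union> {beta_phi \<phi> v | v. v \<in> carrier_vec m}))"

end

theory Submission
  imports Defs
begin

text \<open>
  Write \<open>m = 2n - 1\<close>. Comparing blocks in \<open>\<phi> \<phi>\<^sup>-\<^sup>1 = I\<close> gives \<open>c d\<^sup>t = 1\<close>, and shows that the
  \<open>\<alpha>(v)\<close> are exactly the transvections \<open>I + d\<^sup>t w\<close> with \<open>w d\<^sup>t = 0\<close> and the \<open>\<beta>(v)\<close> are exactly the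
  \<open>I + u\<^sup>t c\<close> with \<open>c u\<^sup>t = 0\<close>. Everything rests on the commutator formula
  \<open>[I + x y, I + x' y'] = I + (y x') x y'\<close>, valid if \<open>y x = y' x' = y' x = 0\<close>.

  The inclusion of \<open>E_phi\<close> in the elementary group is Suslin's argument: a row orthogonal to the
  unimodular \<open>d\<close> is a combination of the rows \<open>d\<^sub>k e\<^sub>l - d\<^sub>l e\<^sub>k\<close>, and these are handled with a third
  index. For the converse, the commutator formula puts \<open>I + x y\<close> with \<open>y x = 0\<close> into \<open>E_phi\<close> as
  soon as \<open>c x = 0\<close> or \<open>y d = 0\<close>. For \<open>i \<noteq> j\<close> the \<open>a\<close> with \<open>I + r a e\<^sub>i\<^sub>j \<in> E_phi\<close> for all \<open>r\<close> form an
  ideal; for every \<open>k \<noteq> i, j\<close>, further commutators show that it contains \<open>c\<^sub>i d\<^sub>j\<close>,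
  \<open>(c\<^sub>j d\<^sub>j + c\<^sub>k d\<^sub>k)\<^sup>2\<close> and \<open>(c\<^sub>i d\<^sub>i + c\<^sub>k d\<^sub>k)\<^sup>2\<close>, and these generate the unit ideal because
  \<open>c d\<^sup>t = 1\<close>.

  That Pfaffian 1 implies invertibility follows since the Pfaffian is linear in each line
  (a row together with the corresponding column) and vanishes if two lines agree: the swap of the
  two lines acts on perfect matchings as a sign-reversing involution.
\<close>

subsection \<open>Transvections\<close>

text \<open>Vectors of length \<open>m\<close> are functions on \<^typ>\<open>nat\<close> of which only the values below \<open>m\<close>
  matter; \<open>tv m x y\<close> is \<open>I + x y\<close> with \<open>x\<close> a column and \<open>y\<close> a row.\<close>

definition dot :: "nat \<Rightarrow> (nat \<Rightarrow> 'a::comm_ring_1) \<Rightarrow> (nat \<Rightarrow> 'a) \<Rightarrow> 'a" where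
  "dot m x y = (\<Sum>i<m. x i * y i)"

definition ev :: "nat \<Rightarrow> nat \<Rightarrow> 'a::comm_ring_1" where
  "ev i k = (if k = i then 1 else 0)"

definition tv :: "nat \<Rightarrow> (nat \<Rightarrow> 'a::comm_ring_1) \<Rightarrow> (nat \<Rightarrow> 'a) \<Rightarrow> 'a mat" where
  "tv m x y = mat m m (\<lambda>(i,j). (if i = j then 1 else 0) + x i * y j)"

lemma dot_commute: "dot m x y = dot m y x"
  by (simp add: dot_def mult.commute)

lemma dot_simps [simp]:
  "dot m (\<lambda>i. x i + y i) z = dot m x z + dot m y z"
  "dot m z (\<lambda>i. x i + y i) = dot m z x + dot m z y"
  "dot m (\<lambda>i. x i - y i) z = dot m x z - dot m y z"
  "dot m z (\<lambda>i. x i - y i) = dot m z x - dot m z y"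
  "dot m (\<lambda>i. - x i) z = - dot m x z"
  "dot m z (\<lambda>i. - x i) = - dot m z x"
  "dot m (\<lambda>i. a * x i) z = a * dot m x z"
  "dot m z (\<lambda>i. a * x i) = a * dot m z x"
  "dot m (\<lambda>i. 0) z = 0"
  "dot m z (\<lambda>i. 0) = 0"
  by (simp_all add: dot_def algebra_simps sum.distrib sum_subtractf sum_negf sum_distrib_left)

lemma dot_ev [simp]:
  assumes "i < m"
  shows "dot m (ev i) x = x i" "dot m x (ev i) = x i"
  using assms by (simp_all add: dot_def ev_def if_distrib if_distribR cong: if_cong)

lemma ev_simps [simp]: "ev i i = 1" "i \<noteq> k \<Longrightarrow> ev i k = 0"
  by (simp_all add: ev_def)

lemma dot_sum [simp]:
  "dot m (\<lambda>i. \<Sum>p\<in>F. Y p i) z = (\<Sum>p\<in>F. dot m (Y p) z)"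
  "dot m z (\<lambda>i. \<Sum>p\<in>F. Y p i) = (\<Sum>p\<in>F. dot m z (Y p))"
  unfolding dot_def sum_distrib_left sum_distrib_right by (rule sum.swap)+

lemma ev_expand: "l < m \<Longrightarrow> x l = (\<Sum>i<m. x i * ev i l)"
  by (simp add: ev_def if_distrib cong: if_cong)

lemma tv_carrier [simp]: "tv m x y \<in> carrier_mat m m"
  by (simp add: tv_def)

lemma tv_cong:
  assumes "\<And>i. i < m \<Longrightarrow> x i = x' i" "\<And>i. i < m \<Longrightarrow> y i = y' i"
  shows "tv m x y = tv m x' y'"
  unfolding tv_def using assms by (intro cong_mat) auto

lemma tv_scale: "tv m (\<lambda>i. a * x i) y = tv m x (\<lambda>i. a * y i)"
  by (simp add: tv_def mult_ac)

lemma tv_zero [simp]: "tv m x (\<lambda>i. 0) = 1\<^sub>m m" "tv m (\<lambda>i. 0) y = 1\<^sub>m m"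
  by (auto simp: tv_def one_mat_def)

lemma elem_mat_tv: "elem_mat m i j a = tv m (ev i) (\<lambda>k. a * ev j k)"
  by (intro eq_matI) (auto simp: elem_mat_def tv_def ev_def)

lemma tv_mult:
  "tv m x y * tv m x' y' =
    mat m m (\<lambda>(i,j). (if i = j then 1 else 0) + x i * y j + x' i * y' j + dot m y x' * x i * y' j)"
proof (rule eq_matI)
  fix i j assume "i < dim_row (mat m m (\<lambda>(i,j). (if i = j then 1 else 0) + x i * y j + x' i * y' j + dot m y x' * x i * y' j))"
     "j < dim_col (mat m m (\<lambda>(i,j). (if i = j then 1 else 0) + x i * y j + x' i * y' j + dot m y x' * x i * y' j))"
  then have ij: "i < m" "j < m" by auto
  have "(tv m x y * tv m x' y') $$ (i,j) =
      (\<Sum>k<m. ((if i = k then 1 else 0) + x i * y k) * ((if k = j then 1 else 0) + x' k * y' j))"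
    using ij by (simp add: tv_def scalar_prod_def lessThan_atLeast0)
  also have "\<dots> = (\<Sum>k<m. (if k = i then (if i = j then 1 else 0) else 0)
        + (if k = j then x i * y j else 0) + (if k = i then x' i * y' j else 0)
        + y k * x' k * (x i * y' j))"
    by (intro sum.cong) (auto simp: algebra_simps)
  also have "\<dots> = (if i = j then 1 else 0) + x i * y j + x' i * y' j + dot m y x' * (x i * y' j)"
    using ij by (simp add: sum.distrib dot_def sum_distrib_right)
  finally show "(tv m x y * tv m x' y') $$ (i,j) =
      mat m m (\<lambda>(i,j). (if i = j then 1 else 0) + x i * y j + x' i * y' j + dot m y x' * x i * y' j) $$ (i,j)"
    using ij by (simp add: mult.assoc)
qed (auto simp: tv_def)

lemma tv_mult_right: "dot m y x = 0 \<Longrightarrow> tv m x y * tv m x y' = tv m x (\<lambda>i. y i + y' i)"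
  unfolding tv_mult by (simp add: tv_def algebra_simps)

lemma tv_mult_left: "dot m y x' = 0 \<Longrightarrow> tv m x y * tv m x' y = tv m (\<lambda>i. x i + x' i) y"
  unfolding tv_mult by (simp add: tv_def algebra_simps)

lemma tv_inverse: "dot m y x = 0 \<Longrightarrow> tv m x y * tv m x (\<lambda>i. - y i) = 1\<^sub>m m"
  by (simp add: tv_mult_right)

text \<open>As \<open>y' x = 0\<close>, the product \<open>B A\<close> has no cross term, while
  \<open>A B\<close> has the cross term \<open>(y x') x y'\<close>. The left factor \<open>C\<close>
  supplies exactly this term, so \<open>C B A = A B\<close>.\<close>

lemma tv_commutator:
  assumes "dot m y x = 0" "dot m y' x' = 0" "dot m y' x = 0"
  shows "tv m x y * tv m x' y' * (tv m x (\<lambda>i. - y i) * tv m x' (\<lambda>i. - y' i))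
    = tv m (\<lambda>i. dot m y x' * x i) y'"
proof -
  define A B A' B' C where defs: "A = tv m x y" "B = tv m x' y'" "A' = tv m x (\<lambda>i. - y i)"
    "B' = tv m x' (\<lambda>i. - y' i)" "C = tv m (\<lambda>i. dot m y x' * x i) y'"
  have car: "A \<in> carrier_mat m m" "B \<in> carrier_mat m m" "A' \<in> carrier_mat m m"
    "B' \<in> carrier_mat m m" "C \<in> carrier_mat m m" by (simp_all add: defs)
  have BA: "B * A = mat m m (\<lambda>(i,j). (if i = j then 1 else 0) + x' i * y' j + x i * y j)"
    unfolding defs tv_mult by (simp add: assms)
  have "C * (B * A) = (C * B) * A"
    using car by (simp add: assoc_mult_mat[of _ m m _ m _ m])
  also have "C * B = tv m (\<lambda>i. dot m y x' * x i + x' i) y'"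
    unfolding defs by (rule tv_mult_left) (simp add: assms)
  also have "\<dots> * A = A * B"
    unfolding defs tv_mult by (simp add: assms algebra_simps)
  finally have 1: "C * (B * A) = A * B" .
  have "A * B * (A' * B') = C * (B * A) * (A' * B')" by (simp add: 1)
  also have "\<dots> = C * (B * (A * A') * B')"
    using car by (simp add: assoc_mult_mat[of _ m m _ m _ m])
  also have "A * A' = 1\<^sub>m m" unfolding defs by (rule tv_inverse) fact
  also have "B * 1\<^sub>m m * B' = B * B'" using car by simp
  also have "B * B' = 1\<^sub>m m" unfolding defs by (rule tv_inverse) fact
  finally show ?thesis using car unfolding defs by simp
qed

section \<open>Membership rules for transvections in generated subgroups\<close>

lemma gen_subgroup_least:
  assumes "\<And>A. A \<in> S \<Longrightarrow> A \<in> carrier_mat m m \<Longrightarrow> A \<in> gen_subgroup m T"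
  shows "gen_subgroup m S \<subseteq> gen_subgroup m T"
proof
  fix A assume "A \<in> gen_subgroup m S"
  then show "A \<in> gen_subgroup m T"
    by induction (auto intro: assms gen_subgroup.intros)
qed

lemma tv_uminus_mem:
  "tv m x y \<in> gen_subgroup m S \<Longrightarrow> dot m y x = 0 \<Longrightarrow> tv m x (\<lambda>i. - y i) \<in> gen_subgroup m S"
  by (rule gen_inv[OF _ _ tv_inverse]) auto

lemma tv_add_right_mem:
  "tv m x y \<in> gen_subgroup m S \<Longrightarrow> tv m x y' \<in> gen_subgroup m S \<Longrightarrow> dot m y x = 0
    \<Longrightarrow> tv m x (\<lambda>i. y i + y' i) \<in> gen_subgroup m S"
  using gen_mult[of "tv m x y" m S "tv m x y'"] by (simp add: tv_mult_right)

lemma tv_add_left_mem: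
  "tv m x y \<in> gen_subgroup m S \<Longrightarrow> tv m x' y \<in> gen_subgroup m S \<Longrightarrow> dot m y x' = 0
    \<Longrightarrow> tv m (\<lambda>i. x i + x' i) y \<in> gen_subgroup m S"
  using gen_mult[of "tv m x y" m S "tv m x' y"] by (simp add: tv_mult_left)

lemma tv_sum_right_mem:
  assumes "finite F" "\<And>p. p \<in> F \<Longrightarrow> tv m x (Y p) \<in> gen_subgroup m S"
    "\<And>p. p \<in> F \<Longrightarrow> dot m (Y p) x = 0"
  shows "tv m x (\<lambda>i. \<Sum>p\<in>F. Y p i) \<in> gen_subgroup m S"
  using assms by (induction F rule: finite_induct) (simp_all add: gen_one tv_add_right_mem)

lemma tv_sum_left_mem:
  assumes "finite F" "\<And>p. p \<in> F \<Longrightarrow> tv m (X p) y \<in> gen_subgroup m S"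
    "\<And>p. p \<in> F \<Longrightarrow> dot m y (X p) = 0"
  shows "tv m (\<lambda>i. \<Sum>p\<in>F. X p i) y \<in> gen_subgroup m S"
  using assms by (induction F rule: finite_induct) (simp_all add: gen_one tv_add_left_mem)

lemma tv_commutator_mem:
  assumes "tv m x y \<in> gen_subgroup m S" "tv m x' y' \<in> gen_subgroup m S"
    "dot m y x = 0" "dot m y' x' = 0" "dot m y' x = 0"
  shows "tv m (\<lambda>i. dot m y x' * x i) y' \<in> gen_subgroup m S"
  unfolding tv_commutator[OF assms(3-5), symmetric]
  using assms by (intro gen_mult tv_uminus_mem)

subsection \<open>Transvections in the elementary group\<close>

lemma tv_ev_mem_E_group:
  assumes "i < m" "j < m" "i \<noteq> j"
  shows "tv m (ev i) (\<lambda>k. a * ev j k) \<in> E_group m"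
  unfolding E_group_def
  by (rule gen_gen) (use assms in \<open>auto simp: elem_mat_tv[symmetric] elem_mat_def\<close>)

text \<open>Through this spare index the assumption \<open>m \<ge> 3\<close>, that is
  \<open>n \<ge> 2\<close>, enters both inclusions.\<close>

lemma third_index:
  fixes m :: nat
  assumes "m \<ge> 3" "k < m" "l < m" "k \<noteq> l"
  obtains i where "i < m" "i \<noteq> k" "i \<noteq> l"
proof -
  have "card ({..<m} - {k,l}) > 0" using assms by (simp add: card_Diff_subset)
  then show ?thesis using that
    by (metis DiffE card_gt_0_iff ex_in_conv insertCI lessThan_iff)
qed

text \<open>Each coordinate of \<open>y\<close> off \<open>k\<close> and \<open>l\<close>
  contributes a product of two elementary matrices. The part of \<open>y\<close> on \<open>k\<close>
  and \<open>l\<close> is still orthogonal to \<open>w\<close>, and it arises from a commutator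
  through a third index \<open>i\<close>.\<close>

lemma pair_tv_mem_E_group_left:
  assumes m: "m \<ge> 3" and kl: "k < m" "l < m" "k \<noteq> l"
    and w: "w = (\<lambda>i. p * ev k i + q * ev l i)" and orth: "dot m y w = 0"
  shows "tv m w y \<in> E_group m"
proof -
  obtain i where i: "i < m" "i \<noteq> k" "i \<noteq> l" using third_index[OF m kl] .
  note E = E_group_def
  have off: "tv m w (\<lambda>s. a * ev j s) \<in> E_group m" if j: "j < m" "j \<noteq> k" "j \<noteq> l" for a j
  proof -
    have "tv m (\<lambda>i. p * ev k i) (\<lambda>s. a * ev j s) \<in> E_group m"
      using tv_ev_mem_E_group[of k m j "p * a"] j kl by (simp add: tv_scale mult.assoc)
    moreover have "tv m (\<lambda>i. q * ev l i) (\<lambda>s. a * ev j s) \<in> E_group m"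
      using tv_ev_mem_E_group[of l m j "q * a"] j kl by (simp add: tv_scale mult.assoc)
    ultimately show ?thesis
      unfolding w E by (rule tv_add_left_mem) (use j kl in simp)
  qed
  let ?y = "\<lambda>s. y k * ev k s + y l * ev l s"
  have yw: "dot m ?y w = 0" using orth kl by (simp add: w mult.commute)
  have "tv m (ev i) ?y \<in> E_group m"
    unfolding E by (rule tv_add_right_mem)
      (use i kl tv_ev_mem_E_group[of i m k] tv_ev_mem_E_group[of i m l] in \<open>auto simp: E\<close>)
  moreover have "tv m w (ev i) \<in> E_group m" using off[of i 1] i by simp
  ultimately have "tv m (\<lambda>s. dot m (ev i) (ev i) * w s) ?y \<in> E_group m"
    unfolding E by (intro tv_commutator_mem) (use i kl yw in \<open>auto simp: w\<close>)
  then have on: "tv m w ?y \<in> E_group m" using i by simp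
  have "tv m w (\<lambda>s. \<Sum>j\<in>{..<m}-{k,l}. y j * ev j s) \<in> E_group m"
    unfolding E by (rule tv_sum_right_mem) (use off kl in \<open>auto simp: E w\<close>)
  with on have "tv m w (\<lambda>s. ?y s + (\<Sum>j\<in>{..<m}-{k,l}. y j * ev j s)) \<in> E_group m"
    unfolding E by (rule tv_add_right_mem) (rule yw)
  also have "tv m w (\<lambda>s. ?y s + (\<Sum>j\<in>{..<m}-{k,l}. y j * ev j s)) = tv m w y"
  proof (rule tv_cong)
    fix s assume "s < m"
    have "y s = (\<Sum>j<m. y j * ev j s)" using \<open>s < m\<close> by (rule ev_expand)
    also have "\<dots> = ?y s + (\<Sum>j\<in>{..<m}-{k,l}. y j * ev j s)"
      using kl sum.subset_diff[of "{k,l}" "{..<m}" "\<lambda>j. y j * ev j s"] by (simp add: add.commute)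
    finally show "?y s + (\<Sum>j\<in>{..<m}-{k,l}. y j * ev j s) = y s" ..
  qed simp
  finally show ?thesis .
qed

text \<open>The mirror image: here the column \<open>x\<close> is split into its part on
  \<open>k\<close> and \<open>l\<close> and the rest.\<close>

lemma pair_tv_mem_E_group_right:
  assumes m: "m \<ge> 3" and kl: "k < m" "l < m" "k \<noteq> l"
    and w: "w = (\<lambda>i. p * ev k i + q * ev l i)" and orth: "dot m w x = 0"
  shows "tv m x w \<in> E_group m"
proof -
  obtain i where i: "i < m" "i \<noteq> k" "i \<noteq> l" using third_index[OF m kl] .
  note E = E_group_def
  have off: "tv m (\<lambda>s. a * ev j s) w \<in> E_group m" if j: "j < m" "j \<noteq> k" "j \<noteq> l" for a j
  proof -
    have "tv m (\<lambda>s. a * ev j s) (\<lambda>i. p * ev k i) \<in> E_group m"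
      using tv_ev_mem_E_group[of j m k "a * p"] j kl by (simp add: tv_scale mult.assoc)
    moreover have "tv m (\<lambda>s. a * ev j s) (\<lambda>i. q * ev l i) \<in> E_group m"
      using tv_ev_mem_E_group[of j m l "a * q"] j kl by (simp add: tv_scale mult.assoc)
    ultimately show ?thesis
      unfolding w E by (rule tv_add_right_mem) (use j kl in simp)
  qed
  let ?x = "\<lambda>s. x k * ev k s + x l * ev l s"
  have xw: "dot m w ?x = 0" using orth kl by (simp add: w mult.commute)
  have "tv m (\<lambda>s. x k * ev k s) (ev i) \<in> E_group m" "tv m (\<lambda>s. x l * ev l s) (ev i) \<in> E_group m"
    using tv_ev_mem_E_group[of k m i] tv_ev_mem_E_group[of l m i] i kl by (auto simp: tv_scale)
  then have "tv m ?x (ev i) \<in> E_group m"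
    unfolding E by (rule tv_add_left_mem) (use i kl in auto)
  moreover have "tv m (ev i) w \<in> E_group m" using off[of i 1] i by simp
  ultimately have "tv m (\<lambda>s. dot m (ev i) (ev i) * ?x s) w \<in> E_group m"
    unfolding E by (rule tv_commutator_mem) (use i kl xw in \<open>auto simp: w\<close>)
  then have on: "tv m ?x w \<in> E_group m" using i by simp
  have "tv m (\<lambda>s. \<Sum>j\<in>{..<m}-{k,l}. x j * ev j s) w \<in> E_group m"
    unfolding E by (rule tv_sum_left_mem) (use off kl in \<open>auto simp: E w\<close>)
  then have "tv m (\<lambda>s. (\<Sum>j\<in>{..<m}-{k,l}. x j * ev j s) + ?x s) w \<in> E_group m"
    using on unfolding E by (rule tv_add_left_mem) (rule xw)
  also have "tv m (\<lambda>s. (\<Sum>j\<in>{..<m}-{k,l}. x j * ev j s) + ?x s) w = tv m x w"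
  proof (rule tv_cong)
    fix s assume "s < m"
    have "x s = (\<Sum>j<m. x j * ev j s)" using \<open>s < m\<close> by (rule ev_expand)
    also have "\<dots> = (\<Sum>j\<in>{..<m}-{k,l}. x j * ev j s) + ?x s"
      using kl sum.subset_diff[of "{k,l}" "{..<m}" "\<lambda>j. x j * ev j s"] by simp
    finally show "(\<Sum>j\<in>{..<m}-{k,l}. x j * ev j s) + ?x s = x s" ..
  qed simp
  finally show ?thesis .
qed

text \<open>The double sum is \<open>(c x) y - (y x) c\<close>. In other words, relations of a
  unimodular vector are generated by the Koszul relations.\<close>

lemma orthogonal_decomposition:
  assumes "dot m c x = 1" "dot m y x = 0" "s < m"
  shows "y s = (\<Sum>(k,l)\<in>{..<m}\<times>{..<m}. y l * c k * (x k * ev l s - x l * ev k s))"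
proof -
  have "(\<Sum>(k,l)\<in>{..<m}\<times>{..<m}. y l * c k * (x k * ev l s - x l * ev k s))
      = (\<Sum>k<m. \<Sum>l<m. y l * ev l s * (c k * x k) - (y l * x l) * (c k * ev k s))"
    by (simp add: sum.cartesian_product[symmetric] algebra_simps)
  also have "\<dots> = (\<Sum>k<m. y s * (c k * x k) - dot m y x * (c k * ev k s))"
    by (simp only: sum_subtractf sum_distrib_right[symmetric] ev_expand[OF assms(3), symmetric]
        dot_def)
  also have "\<dots> = y s * dot m c x"
    by (simp add: assms(2)) (simp add: dot_def sum_distrib_left)
  finally show ?thesis by (simp add: assms)
qed

text \<open>Each Koszul summand of \<open>y\<close> lives on two coordinates and is itself
  orthogonal to \<open>x\<close>, so its transvection is elementary and the transvections of all
  summands multiply to that of \<open>y\<close>.\<close>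

lemma unimodular_tv_mem_E_group:
  assumes m: "m \<ge> 3" and c: "dot m c x = 1" and orth: "dot m y x = 0"
  shows "tv m x y \<in> E_group m" "tv m y x \<in> E_group m"
proof -
  let ?Y = "\<lambda>p s. case p of (k,l) \<Rightarrow> y l * c k * (x k * ev l s - x l * ev k s)"
  have eq: "?Y (k,l) = (\<lambda>s. (y l * c k * x k) * ev l s + (- (y l * c k * x l)) * ev k s)" for k l
    by (auto simp: algebra_simps)
  have o: "dot m (?Y (k,l)) x = 0" if "k < m" "l < m" for k l
    using that by (simp add: algebra_simps)
  have o': "dot m x (?Y (k,l)) = 0" if "k < m" "l < m" for k l
    using o[OF that] by (simp only: dot_commute)
  have 0: "?Y (k,k) = (\<lambda>s. 0)" for k by simp
  have A: "tv m x (?Y (k,l)) \<in> E_group m" if "k < m" "l < m" for k l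
  proof (cases "k = l")
    case True then show ?thesis using 0 by (simp add: gen_one E_group_def)
  next
    case False
    show ?thesis
      using pair_tv_mem_E_group_right[OF m that(2,1) _ eq o[OF that]] False by blast
  qed
  have B: "tv m (?Y (k,l)) x \<in> E_group m" if "k < m" "l < m" for k l
  proof (cases "k = l")
    case True then show ?thesis using 0 by (simp add: gen_one E_group_def)
  next
    case False
    show ?thesis
      using pair_tv_mem_E_group_left[OF m that(2,1) _ eq o'[OF that]] False by blast
  qed
  let ?F = "{..<m}\<times>{..<m}"
  have "tv m x (\<lambda>s. \<Sum>p\<in>?F. ?Y p s) \<in> E_group m"
    unfolding E_group_def using A o by (intro tv_sum_right_mem) (auto simp: E_group_def simp del: dot_simps)
  then show "tv m x y \<in> E_group m"
    using tv_cong[of m x x y, OF refl orthogonal_decomposition[OF c orth]] by simp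
  have "tv m (\<lambda>s. \<Sum>p\<in>?F. ?Y p s) x \<in> E_group m"
    unfolding E_group_def using B o' by (intro tv_sum_left_mem) (auto simp: E_group_def simp del: dot_simps)
  then show "tv m y x \<in> E_group m"
    using tv_cong[of m y _ x x, OF orthogonal_decomposition[OF c orth] refl] by simp
qed

subsection \<open>Radicals of ideals\<close>

definition ring_ideal :: "'a::comm_ring_1 set \<Rightarrow> bool" where
  "ring_ideal J \<longleftrightarrow> 0 \<in> J \<and> (\<forall>a\<in>J. \<forall>b\<in>J. a + b \<in> J) \<and> (\<forall>a\<in>J. \<forall>r. r * a \<in> J)"

lemma ring_ideal_sum: "ring_ideal J \<Longrightarrow> (\<And>p. p \<in> F \<Longrightarrow> f p \<in> J) \<Longrightarrow> sum f F \<in> J"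
  by (induction F rule: infinite_finite_induct) (auto simp: ring_ideal_def)

text \<open>Exponent 0 does no harm for an ideal, since \<open>1 \<in> J\<close> makes
  \<open>J\<close> the whole ring. Radicals allow squares to be dropped without passing to maximal
  ideals.\<close>

definition radical :: "'a::comm_ring_1 set \<Rightarrow> 'a set" where
  "radical J = {a. \<exists>n. a ^ n \<in> J}"

lemma radicalI: "a ^ n \<in> J \<Longrightarrow> a \<in> radical J"
  by (auto simp: radical_def)

text \<open>In \<open>(a + b) ^ (p + q)\<close> every binomial term contains \<open>a ^ p\<close> or
  \<open>b ^ q\<close>.\<close>

lemma ring_ideal_radical:
  assumes J: "ring_ideal J"
  shows "ring_ideal (radical J)"
  unfolding ring_ideal_def
proof (intro conjI ballI allI)
  show "0 \<in> radical J" using J by (intro radicalI[of _ 1]) (simp add: ring_ideal_def)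
next
  fix a r assume "a \<in> radical J"
  then obtain p where "a ^ p \<in> J" by (auto simp: radical_def)
  then show "r * a \<in> radical J"
    using J by (intro radicalI[of _ p]) (simp add: ring_ideal_def power_mult_distrib)
next
  fix a b assume "a \<in> radical J" "b \<in> radical J"
  then obtain p q where pq: "a ^ p \<in> J" "b ^ q \<in> J" by (auto simp: radical_def)
  have "(\<Sum>k\<le>p + q. of_nat (p + q choose k) * a ^ k * b ^ (p + q - k)) \<in> J"
  proof (rule ring_ideal_sum[OF J])
    fix k
    show "of_nat (p + q choose k) * a ^ k * b ^ (p + q - k) \<in> J"
    proof (cases "k \<ge> p")
      case True
      then have "a ^ k = a ^ (k - p) * a ^ p"
        by (simp flip: power_add)
      then have "of_nat (p + q choose k) * a ^ k * b ^ (p + q - k)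
          = (of_nat (p + q choose k) * a ^ (k - p) * b ^ (p + q - k)) * a ^ p"
        by (simp add: mult_ac)
      then show ?thesis using pq J by (simp add: ring_ideal_def)
    next
      case False
      then have "b ^ (p + q - k) = b ^ (p - k) * b ^ q"
        by (simp flip: power_add)
      then show ?thesis using pq J by (simp add: ring_ideal_def flip: mult.assoc)
    qed
  qed
  then show "a + b \<in> radical J"
    by (intro radicalI[of _ "p + q"]) (simp add: binomial_ring)
qed

subsection \<open>Elementary matrices from two transvection subgroups\<close>

text \<open>All that the converse inclusion uses of \<open>\<phi>\<close>: a dual pair
  \<open>c\<close>, \<open>d\<close> and the two full families of transvections with column
  \<open>d\<close> or row \<open>c\<close>.\<close>

locale transvection_pair =
  fixes m :: nat and S :: "'a::comm_ring_1 mat set" and c d :: "nat \<Rightarrow> 'a"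
  assumes m: "m \<ge> 3" and cd: "dot m c d = 1"
    and row_mem: "\<And>w. dot m w d = 0 \<Longrightarrow> tv m d w \<in> gen_subgroup m S"
    and col_mem: "\<And>u. dot m c u = 0 \<Longrightarrow> tv m u c \<in> gen_subgroup m S"
begin

abbreviation "G \<equiv> gen_subgroup m S"

text \<open>The commutator of \<open>I + u c\<close> and \<open>I + d w\<close> is
  \<open>I + (c d) u w\<close>, and \<open>c d = 1\<close>.\<close>

lemma tv_both_mem:
  assumes "dot m c u = 0" "dot m w d = 0" "dot m w u = 0"
  shows "tv m u w \<in> G"
  using tv_commutator_mem[OF col_mem[of u] row_mem[of w]] assms by (simp add: cd)

text \<open>With \<open>b = y d\<close>, split \<open>y\<close> into \<open>b c\<close>, which the
  column family covers, and \<open>y - b c\<close>, which is orthogonal to \<open>d\<close> because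
  \<open>c d = 1\<close>.\<close>

lemma tv_left_mem:
  assumes u: "dot m c u = 0" and yu: "dot m y u = 0"
  shows "tv m u y \<in> G"
proof -
  let ?b = "dot m y d"
  have "tv m u (\<lambda>i. ?b * c i) \<in> G"
    unfolding tv_scale[symmetric] by (rule col_mem) (simp add: u)
  moreover have "tv m u (\<lambda>i. y i - ?b * c i) \<in> G"
    by (rule tv_both_mem) (simp_all add: u yu cd)
  ultimately have "tv m u (\<lambda>i. ?b * c i + (y i - ?b * c i)) \<in> G"
    by (rule tv_add_right_mem) (simp add: u)
  then show ?thesis by simp
qed

text \<open>Dually, the column \<open>x\<close> is split along \<open>d\<close>.\<close>

lemma tv_right_mem:
  assumes y: "dot m y d = 0" and yx: "dot m y x = 0"
  shows "tv m x y \<in> G"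
proof -
  let ?a = "dot m c x"
  have "tv m (\<lambda>i. ?a * d i) y \<in> G"
    unfolding tv_scale by (rule row_mem) (simp add: y)
  moreover have "tv m (\<lambda>i. x i - ?a * d i) y \<in> G"
    by (rule tv_both_mem) (simp_all add: y yx cd)
  ultimately have "tv m (\<lambda>i. ?a * d i + (x i - ?a * d i)) y \<in> G"
    by (rule tv_add_left_mem) (simp add: y yx)
  then show ?thesis by simp
qed

text \<open>At a maximal ideal containing the three families of elements below, either
  \<open>c i = 0\<close> or \<open>d j = 0\<close>, whence \<open>c l * d l = 0\<close> for every \<open>l\<close>, contradicting \<open>dot m c d = 1\<close>;
  so \<open>level i j\<close> is the unit ideal.\<close>

definition level :: "nat \<Rightarrow> nat \<Rightarrow> 'a set" where
  "level i j = {a. \<forall>r. tv m (ev i) (\<lambda>k. (r * a) * ev j k) \<in> G}"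

text \<open>Closure under ring multiples is built in through the quantifier over \<open>r\<close>;
  for sums, \<open>i \<noteq> j\<close> lets the transvections be multiplied.\<close>

lemma level_ideal:
  assumes "i < m" "j < m" "i \<noteq> j"
  shows "ring_ideal (level i j)"
  unfolding ring_ideal_def
proof (intro conjI ballI allI)
  show "0 \<in> level i j" by (simp add: level_def gen_one)
next
  fix a b assume "a \<in> level i j" "b \<in> level i j"
  then show "a + b \<in> level i j"
    unfolding level_def
    using tv_add_right_mem[of m "ev i" "\<lambda>k. (_ * a) * ev j k" S "\<lambda>k. (_ * b) * ev j k"] assms
    by (auto simp: distrib_left distrib_right)
next
  fix a r assume "a \<in> level i j"
  then show "r * a \<in> level i j" by (auto simp: level_def mult.assoc[symmetric])
qed

context
  fixes i j k :: nat
  assumes ij: "i < m" "j < m" "i \<noteq> j" and k: "k < m" "k \<noteq> i" "k \<noteq> j"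
begin

text \<open>The row \<open>d j * ev k - d k * ev j\<close> is orthogonal to \<open>d\<close> and the
  column \<open>c i * ev k - c k * ev i\<close> to \<open>c\<close>. They share only the index
  \<open>k\<close>, so their pairing is \<open>c i * d j\<close>.\<close>

lemma level_cross: "c i * d j \<in> level i j"
proof -
  have "tv m (ev i) (\<lambda>l. (r * (c i * d j)) * ev j l) \<in> G" for r
  proof -
    let ?y = "\<lambda>l. d j * ev k l - d k * ev j l" and ?x = "\<lambda>l. c i * ev k l - c k * ev i l"
    have "tv m (ev i) ?y \<in> G"
      by (rule tv_right_mem) (use ij k in \<open>simp_all add: mult.commute\<close>)
    moreover have "tv m ?x (\<lambda>l. r * ev j l) \<in> G"
      by (rule tv_left_mem) (use ij k in \<open>simp_all add: mult.commute\<close>)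
    ultimately have "tv m (\<lambda>l. dot m ?y ?x * ev i l) (\<lambda>l. r * ev j l) \<in> G"
      by (rule tv_commutator_mem) (use ij k in simp_all)
    moreover have "dot m ?y ?x = c i * d j" using ij k by (simp add: mult.commute)
    ultimately show ?thesis by (simp add: tv_scale mult_ac)
  qed
  then show ?thesis by (simp add: level_def)
qed

text \<open>A Koszul row for \<open>d\<close> and a Koszul column for \<open>c\<close>, both on
  \<open>j\<close> and \<open>k\<close>, pair to \<open>?t\<close>. The row \<open>?y'\<close> is
  chosen orthogonal to the column \<open>?x'\<close>, so that the commutator formula
  applies.\<close>

lemma level_right: "(c j * d j + c k * d k) ^ 2 \<in> level i j"
proof -
  let ?t = "c j * d j + c k * d k"
  have "tv m (ev i) (\<lambda>l. (r * ?t ^ 2) * ev j l) \<in> G" for r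
  proof -
    let ?y = "\<lambda>l. d k * ev j l - d j * ev k l" and ?x' = "\<lambda>l. c k * ev j l - c j * ev k l"
      and ?y' = "\<lambda>l. (r * d j) * (c j * ev j l + c k * ev k l)"
    have y: "tv m (ev i) (\<lambda>l. a * ?y l) \<in> G" for a
      by (rule tv_right_mem) (use ij k in \<open>simp_all add: mult.commute\<close>)
    have "tv m (\<lambda>l. dot m (\<lambda>l. 1 * ?y l) ?x' * ev i l) ?y' \<in> G"
      by (rule tv_commutator_mem[OF y tv_left_mem]) (use ij k in \<open>simp_all add: mult_ac\<close>)
    moreover have "dot m (\<lambda>l. 1 * ?y l) ?x' = ?t" using ij k by (simp add: mult.commute)
    ultimately have "tv m (ev i) (\<lambda>l. ?t * ?y' l) \<in> G" by (simp add: tv_scale)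
    \<comment> \<open>The added multiple of \<open>?y\<close> cancels the coefficient at
      \<open>k\<close> and completes the one at \<open>j\<close> to
      \<open>r * ?t ^ 2\<close>.\<close>
    then have "tv m (ev i) (\<lambda>l. ?t * ?y' l + (r * ?t * c k) * ?y l) \<in> G"
      using y by (rule tv_add_right_mem) (use ij k in simp)
    also have "(\<lambda>l. ?t * ?y' l + (r * ?t * c k) * ?y l) = (\<lambda>l. (r * ?t ^ 2) * ev j l)"
      by (simp add: algebra_simps power2_eq_square)
    finally show ?thesis .
  qed
  then show ?thesis by (simp add: level_def)
qed

text \<open>The same computation with rows and columns exchanged, now on the indices
  \<open>i\<close> and \<open>k\<close>; a multiple of \<open>?x'\<close> does the final
  correction.\<close>

lemma level_left: "(c i * d i + c k * d k) ^ 2 \<in> level i j"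
proof -
  let ?t = "c i * d i + c k * d k"
  have "tv m (ev i) (\<lambda>l. (r * ?t ^ 2) * ev j l) \<in> G" for r
  proof -
    let ?y = "\<lambda>l. d k * ev i l - d i * ev k l" and ?x' = "\<lambda>l. c k * ev i l - c i * ev k l"
      and ?x = "\<lambda>l. (r * c i) * (d i * ev i l + d k * ev k l)"
    have x': "tv m (\<lambda>l. a * ?x' l) (ev j) \<in> G" for a
      by (rule tv_left_mem) (use ij k in \<open>simp_all add: mult.commute\<close>)
    have "tv m (\<lambda>l. dot m ?y (\<lambda>l. 1 * ?x' l) * ?x l) (ev j) \<in> G"
      by (rule tv_commutator_mem[OF tv_right_mem x']) (use ij k in \<open>simp_all add: mult_ac\<close>)
    moreover have "dot m ?y (\<lambda>l. 1 * ?x' l) = ?t" using ij k by (simp add: mult.commute)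
    ultimately have "tv m (\<lambda>l. ?t * ?x l) (ev j) \<in> G" by simp
    then have "tv m (\<lambda>l. ?t * ?x l + (r * ?t * d k) * ?x' l) (ev j) \<in> G"
      using x' by (rule tv_add_left_mem) (use ij k in simp)
    also have "(\<lambda>l. ?t * ?x l + (r * ?t * d k) * ?x' l) = (\<lambda>l. (r * ?t ^ 2) * ev i l)"
      by (simp add: algebra_simps power2_eq_square)
    finally show ?thesis by (simp only: tv_scale)
  qed
  then show ?thesis by (simp add: level_def)
qed

end

text \<open>Modulo the radical \<open>N\<close>, with \<open>z l = c l * d l\<close>, the three
  families say \<open>z i * z j = 0\<close> and \<open>z j = - z k = z i\<close>. Hence
  \<open>z j\<close> squares to zero, all \<open>z l\<close> vanish, and so does their sum
  1.\<close>

lemma one_mem_level: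
  assumes ij: "i < m" "j < m" "i \<noteq> j"
  shows "1 \<in> level i j"
proof -
  define N where "N = radical (level i j)"
  define z where "z l = c l * d l" for l
  have N: "ring_ideal N" unfolding N_def by (intro ring_ideal_radical level_ideal ij)
  have add: "a + b \<in> N" if "a \<in> N" "b \<in> N" for a b using N that by (simp add: ring_ideal_def)
  have mult: "r * a \<in> N" if "a \<in> N" for a r using N that by (simp add: ring_ideal_def)
  have diff: "a - b \<in> N" if "a \<in> N" "b \<in> N" for a b
    using add[OF that(1) mult[OF that(2), of "-1"]] by simp
  have sq: "a \<in> N" if aa: "a * a \<in> N" for a
  proof -
    obtain q where "(a * a) ^ q \<in> level i j" using aa unfolding N_def radical_def by blast
    then show ?thesis unfolding N_def
      by (intro radicalI[of _ "2 * q"]) (simp add: power_mult power2_eq_square)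
  qed
  have main: "z i \<in> N \<and> z j \<in> N \<and> z k \<in> N" if k: "k < m" "k \<noteq> i" "k \<noteq> j" for k
  proof -
    have "c i * d j \<in> N" unfolding N_def
      by (intro radicalI[of _ 1]) (simp add: level_cross[OF ij k])
    from mult[OF this, of "c j * d i"] have 1: "z i * z j \<in> N" by (simp add: z_def mult_ac)
    have 2: "z j + z k \<in> N" unfolding N_def z_def
      by (rule radicalI[OF level_right[OF ij k]])
    have 3: "z i + z k \<in> N" unfolding N_def z_def
      by (rule radicalI[OF level_left[OF ij k]])
    \<comment> \<open>This combination of the three relations is \<open>z j * z j\<close>.\<close>
    have "z j * (z j + z k) - z j * (z i + z k) + z i * z j \<in> N"
      by (rule add[OF diff[OF mult[OF 2] mult[OF 3]] 1])
    then have "z j * z j \<in> N" by (simp add: algebra_simps)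
    then have j: "z j \<in> N" by (rule sq)
    have k: "z k \<in> N" using diff[OF 2 j] by simp
    show ?thesis using diff[OF 3 k] j k by simp
  qed
  \<comment> \<open>One third index is required to reach \<open>z i\<close> and \<open>z j\<close>;
    every other \<open>z l\<close> comes from \<open>main\<close> with \<open>k = l\<close>.\<close>
  obtain k where "k < m" "k \<noteq> i" "k \<noteq> j" using third_index[OF m ij] .
  then have "z l \<in> N" if "l < m" for l using main that by blast
  then have "(\<Sum>l<m. z l) \<in> N" by (intro ring_ideal_sum[OF N]) simp
  then show ?thesis using cd by (simp add: z_def dot_def N_def radical_def)
qed

lemma E_group_subset: "E_group m \<subseteq> G"
  unfolding E_group_def
proof (rule gen_subgroup_least)
  fix A :: "'a mat" assume "A \<in> {elem_mat m i j a |i j a. i < m \<and> j < m \<and> i \<noteq> j}"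
  then obtain i j a where A: "A = elem_mat m i j a" "i < m" "j < m" "i \<noteq> j" by auto
  then show "A \<in> G" using one_mem_level[of i j] by (auto simp: elem_mat_tv level_def)
qed

end

subsection \<open>Pfaffians\<close>

text \<open>The index set of the sum in \<open>pfaffian\<close>: one representative for each perfect
  matching, by \<open>ex_normal_perm\<close> and \<open>normal_perm_eqI\<close>.\<close>

definition normal_perms :: "nat \<Rightarrow> (nat \<Rightarrow> nat) set" where
  "normal_perms n = {s. s permutes {..<2*n} \<and> (\<forall>i<n. s (2*i) < s (2*i+1))
                 \<and> (\<forall>i. Suc i < n \<longrightarrow> s (2*i) < s (2*i+2))}"

definition matching :: "nat \<Rightarrow> (nat \<Rightarrow> nat) \<Rightarrow> nat set set" where
  "matching n s = (\<lambda>i. {s (2*i), s (2*i+1)}) ` {..<n}"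

definition pf_term :: "nat \<Rightarrow> (nat \<Rightarrow> nat \<Rightarrow> 'a::comm_ring_1) \<Rightarrow> (nat \<Rightarrow> nat) \<Rightarrow> 'a" where
  "pf_term n A s = signof s * (\<Prod>i<n. A (s (2*i)) (s (2*i+1)))"

definition pf :: "nat \<Rightarrow> (nat \<Rightarrow> nat \<Rightarrow> 'a::comm_ring_1) \<Rightarrow> 'a" where
  "pf n A = (\<Sum>s\<in>normal_perms n. pf_term n A s)"

text \<open>Stated for all indices, so that no ranges have to be carried along; a matrix is later
  extended by zero.\<close>

definition alt_fun :: "(nat \<Rightarrow> nat \<Rightarrow> 'a::comm_ring_1) \<Rightarrow> bool" where
  "alt_fun A \<longleftrightarrow> (\<forall>i. A i i = 0) \<and> (\<forall>i j. A i j = - A j i)"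

lemma alt_fun_diag: "alt_fun A \<Longrightarrow> A i i = 0"
  and alt_fun_skew: "alt_fun A \<Longrightarrow> A i j = - A j i"
  unfolding alt_fun_def by blast+

lemma finite_normal_perms: "finite (normal_perms n)"
  by (rule finite_subset[OF _ finite_permutations[of "{..<2*n}"]]) (auto simp: normal_perms_def)

section \<open>Perfect matchings and their normal representatives\<close>

lemma sign_permutes_compose:
  "p permutes {..<N::nat} \<Longrightarrow> q permutes {..<N} \<Longrightarrow> sign (p \<circ> q) = sign p * sign q"
  by (rule sign_compose; rule permutes_imp_permutation[of "{..<N}"]; simp)

text \<open>Exchanging the two ends of pair \<open>i\<close> negates both the sign of the
  permutation and the matrix entry of that pair.\<close>

lemma pf_term_flip:
  assumes s: "s permutes {..<2*n}" and A: "alt_fun A" and i: "i < n"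
  defines "t \<equiv> s \<circ> transpose (2*i) (2*i+1)"
  shows "t permutes {..<2*n}" "matching n t = matching n s" "pf_term n A t = pf_term n A s"
    "t (2*i) = s (2*i+1)" "j \<noteq> i \<Longrightarrow> t (2*j) = s (2*j)"
proof -
  have tr: "transpose (2*i) (2*i+1) permutes {..<2*n}"
    by (rule permutes_swap_id) (use i in auto)
  show t: "t permutes {..<2*n}" unfolding t_def by (rule permutes_compose[OF tr s])
  have odd: "2*j \<noteq> 2*i+1" "2*j+1 \<noteq> 2*i" for j by presburger+
  have ti: "t (2*i) = s (2*i+1)" "t (2*i+1) = s (2*i)" by (simp_all add: t_def)
  have tj: "t (2*j) = s (2*j)" "t (2*j+1) = s (2*j+1)" if "j \<noteq> i" for j
    using that odd by (simp_all add: t_def transpose_def)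
  show "t (2*i) = s (2*i+1)" "j \<noteq> i \<Longrightarrow> t (2*j) = s (2*j)" using ti tj by auto
  have "{t (2*j), t (2*j+1)} = {s (2*j), s (2*j+1)}" for j
    using ti tj[of j] by (cases "j = i") auto
  then show "matching n t = matching n s" by (simp only: matching_def)
  have "sign t = - sign s"
    unfolding t_def sign_permutes_compose[OF s tr] by (simp add: sign_swap_id)
  moreover have "(\<Prod>j<n. A (t (2*j)) (t (2*j+1))) = - (\<Prod>j<n. A (s (2*j)) (s (2*j+1)))"
  proof -
    have "(\<Prod>j<n. A (t (2*j)) (t (2*j+1)))
        = A (t (2*i)) (t (2*i+1)) * (\<Prod>j\<in>{..<n}-{i}. A (t (2*j)) (t (2*j+1)))"
      by (rule prod.remove) (use i in auto)
    also have "(\<Prod>j\<in>{..<n}-{i}. A (t (2*j)) (t (2*j+1)))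
        = (\<Prod>j\<in>{..<n}-{i}. A (s (2*j)) (s (2*j+1)))"
      by (rule prod.cong[OF refl]) (use tj in auto)
    also have "A (t (2*i)) (t (2*i+1)) = - A (s (2*i)) (s (2*i+1))"
      unfolding ti by (rule alt_fun_skew[OF A])
    also have "- A (s (2*i)) (s (2*i+1)) * (\<Prod>j\<in>{..<n}-{i}. A (s (2*j)) (s (2*j+1)))
        = - (\<Prod>j<n. A (s (2*j)) (s (2*j+1)))"
      by (subst prod.remove[of "{..<n}" i]) (use i in auto)
    finally show ?thesis .
  qed
  ultimately show "pf_term n A t = pf_term n A s" by (simp add: pf_term_def)
qed

text \<open>Pairs \<open>i\<close> and \<open>i + 1\<close> trade places by two transpositions, so
  the sign stays and the factors are only reordered.\<close>

lemma pf_term_swap: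
  assumes s: "s permutes {..<2*n}" and i: "Suc i < n"
  defines "t \<equiv> s \<circ> (transpose (2*i) (2*i+2) \<circ> transpose (2*i+1) (2*i+3))"
  shows "t permutes {..<2*n}" "matching n t = matching n s" "pf_term n A t = pf_term n A s"
    "t (2*j) = s (2 * transpose i (Suc i) j)"
proof -
  let ?p = "transpose (2*i) (2*i+2)" and ?q = "transpose (2*i+1) (2*i+3)"
  let ?h = "transpose i (Suc i)"
  have p: "?p permutes {..<2*n}" by (rule permutes_swap_id) (use i in auto)
  have q: "?q permutes {..<2*n}" by (rule permutes_swap_id) (use i in auto)
  have h: "?h permutes {..<n}" by (rule permutes_swap_id) (use i in auto)
  show t: "t permutes {..<2*n}" unfolding t_def by (intro permutes_compose p q s)
  have odd: "2*j \<noteq> 2*i+1" "2*j \<noteq> 2*i+3" "2*j+1 \<noteq> 2*i" "2*j+1 \<noteq> 2*i+2" for j by presburger+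
  have t0: "t (2*j) = s (2 * ?h j)" for j
    using odd[of j] by (auto simp: t_def transpose_def)
  have t1: "t (2*j+1) = s (2 * ?h j + 1)" for j
    using odd by (auto simp: t_def transpose_def numeral_3_eq_3)
  show "t (2*j) = s (2 * ?h j)" by (rule t0)
  have "matching n t = (\<lambda>i. {s (2*i), s (2*i+1)}) ` ?h ` {..<n}"
    unfolding matching_def t0 t1 image_image ..
  then show "matching n t = matching n s"
    by (simp add: matching_def permutes_image[OF h])
  have "sign t = sign s"
    unfolding t_def sign_permutes_compose[OF s permutes_compose[OF q p]] sign_permutes_compose[OF p q]
    by (simp add: sign_swap_id)
  moreover have "(\<Prod>j<n. A (t (2*j)) (t (2*j+1))) = (\<Prod>j<n. A (s (2*j)) (s (2*j+1)))"
    unfolding t0 t1 using prod.permute[OF h, of "\<lambda>j. A (s (2*j)) (s (2*j+1))"]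
    by (simp add: comp_def)
  ultimately show "pf_term n A t = pf_term n A s" by (simp add: pf_term_def)
qed

lemma ex_normal_perm:
  assumes A: "alt_fun A" and "s permutes {..<2*n}"
  shows "\<exists>r\<in>normal_perms n. matching n r = matching n s \<and> pf_term n A r = pf_term n A s"
  using assms(2)
  \<comment> \<open>flipping an unordered pair and swapping adjacent pairs in the wrong order both decrease this weight\<close>
proof (induction "\<Sum>i<n. s (2*i) * (n - i)" arbitrary: s rule: less_induct)
  case less
  note s = \<open>s permutes {..<2*n}\<close>
  consider "s \<in> normal_perms n" | i where "i < n" "\<not> s (2*i) < s (2*i+1)"
    | i where "Suc i < n" "\<not> s (2*i) < s (2*i+2)"
    using s by (auto simp: normal_perms_def)
  then show ?case
  proof cases
    case 1
    then show ?thesis by blast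
  next
    case (2 i)
    define t where "t = s \<circ> transpose (2*i) (2*i+1)"
    note t = pf_term_flip[OF s A 2(1), folded t_def]
    have "s (2*i) \<noteq> s (2*i+1)" using inj_eq[OF permutes_inj[OF s]] by simp
    with 2 have lt: "s (2*i+1) < s (2*i)" by simp
    have "(\<Sum>j<n. t (2*j) * (n - j)) < (\<Sum>j<n. s (2*j) * (n - j))"
    proof (rule sum_strict_mono_ex1)
      show "\<forall>j\<in>{..<n}. t (2*j) * (n - j) \<le> s (2*j) * (n - j)"
      proof
        fix j show "t (2*j) * (n - j) \<le> s (2*j) * (n - j)"
          using lt t(4) t(5)[of j] by (cases "j = i") auto
      qed
      show "\<exists>j\<in>{..<n}. t (2*j) * (n - j) < s (2*j) * (n - j)"
        using lt t(4) 2 by (intro bexI[of _ i]) auto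
    qed simp
    from less(1)[OF this t(1)] show ?thesis unfolding t(2,3) .
  next
    case (3 i)
    define t where "t = s \<circ> (transpose (2*i) (2*i+2) \<circ> transpose (2*i+1) (2*i+3))"
    note t = pf_term_swap[OF s 3(1), folded t_def]
    have "s (2*i) \<noteq> s (2*i+2)" using inj_eq[OF permutes_inj[OF s]] by simp
    with 3 have lt: "s (2*i+2) < s (2*i)" by simp
    have split: "(\<Sum>j<n. f j) = f i + f (Suc i) + (\<Sum>j\<in>{..<n}-{i,Suc i}. f j)" for f :: "nat \<Rightarrow> nat"
      using sum.subset_diff[of "{i, Suc i}" "{..<n}" f] 3 by (simp add: add.commute)
    \<comment> \<open>The two positions carry the weights \<open>a + 1\<close> and \<open>a\<close>,
      so the exchange changes the total by \<open>s (2*i+2) - s (2*i)\<close>, which is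
      negative.\<close>
    obtain a where a: "n - i = Suc a" "n - Suc i = a" using 3 by (metis Suc_diff_Suc Suc_lessD)
    have ti: "t (2*i) = s (2*i+2)" "t (2 * Suc i) = s (2*i)"
      using t(4)[of i] t(4)[of "Suc i"] by simp_all
    have "(\<Sum>j\<in>{..<n}-{i,Suc i}. t (2*j) * (n - j)) = (\<Sum>j\<in>{..<n}-{i,Suc i}. s (2*j) * (n - j))"
      by (rule sum.cong) (auto simp: t(4) transpose_def)
    moreover have "t (2*i) * (n - i) + t (2 * Suc i) * (n - Suc i)
        < s (2*i) * (n - i) + s (2 * Suc i) * (n - Suc i)"
      using lt unfolding ti a by simp
    ultimately have "(\<Sum>j<n. t (2*j) * (n - j)) < (\<Sum>j<n. s (2*j) * (n - j))"
      unfolding split[of "\<lambda>j. t (2*j) * (n - j)"] split[of "\<lambda>j. s (2*j) * (n - j)"] by linarith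
    from less(1)[OF this t(1)] show ?thesis unfolding t(2,3) .
  qed
qed

lemma normal_perm_even_less:
  assumes "r \<in> normal_perms n" "i < j" "j < n"
  shows "r (2*i) < r (2*j)"
  using assms(2,3)
proof (induction j)
  case (Suc j)
  then have "r (2*j) < r (2 * Suc j)" using assms(1) by (auto simp: normal_perms_def)
  then show ?case using Suc by (cases "i = j") (auto intro: less_trans)
qed simp

text \<open>The values at even positions are the minima of the pairs in increasing order, so the
  matching determines them, and then it determines their partners.\<close>

lemma normal_perm_eqI:
  assumes r: "r \<in> normal_perms n" and r': "r' \<in> normal_perms n"
    and eq: "matching n r = matching n r'"
  shows "r = r'"
proof -
  have Min: "Min ` matching n q = (\<lambda>i. q (2*i)) ` {..<n}" if "q \<in> normal_perms n" for q
  proof -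
    have "min (q (2*i)) (q (2*i+1)) = q (2*i)" if "i < n" for i
      using that \<open>q \<in> normal_perms n\<close> by (auto simp: normal_perms_def min_def dest: less_imp_le)
    then show ?thesis unfolding matching_def image_image by (intro image_cong) auto
  qed
  have sorted: "sorted (map (\<lambda>i. q (2*i)) [0..<n]) \<and> distinct (map (\<lambda>i. q (2*i)) [0..<n])"
    if "q \<in> normal_perms n" for q
  proof -
    have "sorted_wrt (<) (map (\<lambda>i. q (2*i)) [0..<n])"
      using normal_perm_even_less[OF that] by (simp add: sorted_wrt_iff_nth_less)
    then show ?thesis by (simp only: strict_sorted_iff)
  qed
  have "map (\<lambda>i. r (2*i)) [0..<n] = map (\<lambda>i. r' (2*i)) [0..<n]"
    using sorted[OF r] sorted[OF r'] Min[OF r] Min[OF r'] eq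
    by (intro sorted_distinct_set_unique) (auto simp: lessThan_atLeast0)
  then have even: "r (2*i) = r' (2*i)" if "i < n" for i using that by simp
  have odd: "r (2*i+1) = r' (2*i+1)" if i: "i < n" for i
  proof -
    have "{r (2*i), r (2*i+1)} \<in> matching n r'" using i eq[symmetric] by (auto simp: matching_def)
    then obtain j where j: "j < n" "{r (2*i), r (2*i+1)} = {r' (2*j), r' (2*j+1)}"
      by (auto simp: matching_def)
    have "r (2*i) < r (2*i+1)" "r' (2*j) < r' (2*j+1)"
      using r r' i j by (auto simp: normal_perms_def)
    with j(2) have *: "r (2*i) = r' (2*j)" "r (2*i+1) = r' (2*j+1)"
      by (auto simp: doubleton_eq_iff)
    have "inj r'" using r' permutes_inj by (auto simp: normal_perms_def)
    then have "i = j" using even[OF i] *(1) by (simp add: inj_eq)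
    then show ?thesis using * by simp
  qed
  show ?thesis
  proof
    fix x
    show "r x = r' x"
    proof (cases "x < 2*n")
      case True
      then have "x div 2 < n" by auto
      moreover have "x = 2 * (x div 2) \<or> x = 2 * (x div 2) + 1" by presburger
      ultimately show ?thesis using even odd by metis
    next
      case False
      then have "q x = x" if "q \<in> normal_perms n" for q
        using that permutes_not_in[of q "{..<2*n}" x] by (simp add: normal_perms_def)
      then show ?thesis using r r' by metis
    qed
  qed
qed

section \<open>Vanishing of the Pfaffian when two lines agree\<close>

lemma matching_cover:
  fixes k :: nat
  assumes s: "s permutes {..<2*n}" and k: "k < 2*n"
  obtains i where "i < n" "s (2*i) = k \<or> s (2*i+1) = k"
proof -
  obtain x where x: "x < 2*n" "s x = k"
    using permutes_image[OF s] k by (metis imageE lessThan_iff)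
  then have "x div 2 < n" by auto
  moreover have "x = 2 * (x div 2) \<or> x = 2 * (x div 2) + 1" by presburger
  ultimately show ?thesis using that x by metis
qed

lemma perm_pair_disjoint:
  fixes i j :: nat
  assumes "s permutes {..<2*n}" "x \<in> {s (2*i), s (2*i+1)}" "x \<in> {s (2*j), s (2*j+1)}"
  shows "i = j"
proof -
  have "a = b" if "s a = s b" for a b using permutes_inj[OF assms(1)] that by (rule injD)
  then have "2*i = 2*j \<or> 2*i = 2*j+1 \<or> 2*i+1 = 2*j \<or> 2*i+1 = 2*j+1"
    using assms(2,3) by (metis empty_iff insert_iff)
  then show ?thesis by presburger
qed

text \<open>Terms are removed in cancelling pairs; \<open>sum g S = - sum g S\<close> alone would
  not suffice, as 2 may be a zero divisor.\<close>

lemma sum_involution_zero: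
  fixes g :: "'b \<Rightarrow> 'a::comm_ring_1"
  assumes "finite S" "\<And>s. s \<in> S \<Longrightarrow> f s \<in> S" "\<And>s. s \<in> S \<Longrightarrow> f (f s) = s"
    "\<And>s. s \<in> S \<Longrightarrow> f s \<noteq> s" "\<And>s. s \<in> S \<Longrightarrow> g (f s) = - g s"
  shows "sum g S = 0"
  using assms
proof (induction S rule: finite_psubset_induct)
  case (psubset S)
  show ?case
  proof (cases "S = {}")
    case False
    then obtain s where s: "s \<in> S" by blast
    let ?T = "S - {s, f s}"
    have "f t \<in> ?T" if t: "t \<in> ?T" for t
    proof -
      have "f t \<noteq> s" using t psubset.prems(2)[of t] by auto
      moreover have "f t \<noteq> f s" using t psubset.prems(2)[of t] psubset.prems(2)[OF s] by auto
      ultimately show ?thesis using t psubset.prems(1) by blast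
    qed
    then have "sum g ?T = 0" using psubset.prems s by (intro psubset.IH) auto
    moreover have "sum g S = sum g ?T + sum g {s, f s}"
      using s psubset.prems(1) psubset.hyps(1) by (intro sum.subset_diff) auto
    moreover have "sum g {s, f s} = 0"
      using psubset.prems(3)[OF s] psubset.prems(4)[OF s] by auto
    ultimately show ?thesis by simp
  qed simp
qed

text \<open>Matchings with the edge \<open>{k,l}\<close> contribute zero. On the others, relabelling
  by the transposition keeps all entries, reverses the sign and has no fixed point.\<close>

lemma pf_eq_zero:
  assumes A: "alt_fun A" and kl: "k < 2*n" "l < 2*n" "k \<noteq> l" "A k l = 0"
    and inv: "\<And>x y. A (transpose k l x) (transpose k l y) = A x y"
  shows "pf n A = 0"
proof -
  let ?\<sigma> = "transpose k l"
  define S where "S = {s \<in> normal_perms n. {k,l} \<notin> matching n s}"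
  have \<sigma>: "?\<sigma> permutes {..<2*n}" by (rule permutes_swap_id) (use kl in auto)
  have perm: "s permutes {..<2*n}" if "s \<in> normal_perms n" for s
    using that by (simp add: normal_perms_def)
  have m\<sigma>: "matching n (?\<sigma> \<circ> s) = (`) ?\<sigma> ` matching n s" for s
    by (simp add: matching_def image_image)
  have t\<sigma>: "pf_term n A (?\<sigma> \<circ> s) = - pf_term n A s" if "s permutes {..<2*n}" for s
    using kl by (simp add: pf_term_def inv sign_permutes_compose[OF \<sigma> that] sign_swap_id)
  \<comment> \<open>The relabelled permutation may fail to be normal, so it is replaced by the
    normal representative of its matching.\<close>
  have "\<exists>r. r \<in> normal_perms n \<and> matching n r = (`) ?\<sigma> ` matching n s \<and> pf_term n A r = - pf_term n A s"
    if "s \<in> normal_perms n" for s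
    using ex_normal_perm[OF A permutes_compose[OF perm[OF that] \<sigma>]] m\<sigma>[of s] t\<sigma>[OF perm[OF that]]
    by auto
  then obtain f where f: "f s \<in> normal_perms n" "matching n (f s) = (`) ?\<sigma> ` matching n s"
      "pf_term n A (f s) = - pf_term n A s" if "s \<in> normal_perms n" for s
    by metis
  have \<sigma>\<sigma>: "(`) ?\<sigma> ` (`) ?\<sigma> ` M = M" for M by (simp add: image_image)
  have "pf n A = sum (pf_term n A) S"
    unfolding pf_def
  proof (rule sum.mono_neutral_right)
    show "\<forall>s\<in>normal_perms n - S. pf_term n A s = 0"
    proof
      fix s assume "s \<in> normal_perms n - S"
      then obtain i where "i < n" "{k,l} = {s (2*i), s (2*i+1)}" by (auto simp: S_def matching_def)
      moreover have "A l k = 0" using alt_fun_skew[OF A, of l k] kl by simp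
      ultimately have "\<exists>i\<in>{..<n}. A (s (2*i)) (s (2*i+1)) = 0"
        using kl by (auto simp: doubleton_eq_iff)
      then have "(\<Prod>i<n. A (s (2*i)) (s (2*i+1))) = 0" by (intro prod_zero) auto
      then show "pf_term n A s = 0" by (simp add: pf_term_def)
    qed
  qed (auto simp: finite_normal_perms S_def)
  also have "\<dots> = 0"
  proof (rule sum_involution_zero[where f = f])
    show "finite S" using finite_normal_perms by (simp add: S_def)
  next
    fix s assume s: "s \<in> S"
    then have sn: "s \<in> normal_perms n" by (simp add: S_def)
    show "pf_term n A (f s) = - pf_term n A s" by (rule f(3)[OF sn])
    show "f (f s) = s"
      by (rule normal_perm_eqI[OF f(1)[OF f(1)[OF sn]] sn])
        (simp only: f(2)[OF sn] f(2)[OF f(1)[OF sn]] \<sigma>\<sigma>)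
    show "f s \<in> S"
    proof -
      have "{k,l} \<notin> (`) ?\<sigma> ` matching n s"
      proof
        assume "{k,l} \<in> (`) ?\<sigma> ` matching n s"
        then have "?\<sigma> ` {k,l} \<in> (`) ?\<sigma> ` (`) ?\<sigma> ` matching n s" by (rule imageI)
        then show False using s unfolding \<sigma>\<sigma> by (simp add: S_def insert_commute)
      qed
      then show ?thesis using f[OF sn] by (simp add: S_def)
    qed
    show "f s \<noteq> s"
    proof
      assume "f s = s"
      then have fix_s: "matching n s = (`) ?\<sigma> ` matching n s" using f(2)[OF sn] by simp
      \<comment> \<open>Let \<open>a\<close> be the partner of \<open>k\<close>. A matching fixed by
        the swap would also contain \<open>{l,a}\<close>, giving \<open>a\<close> two
        partners.\<close>
      obtain i where i: "i < n" "s (2*i) = k \<or> s (2*i+1) = k"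
        using matching_cover[OF perm[OF sn] kl(1)] .
      define a where "a = (if s (2*i) = k then s (2*i+1) else s (2*i))"
      have pair: "{s (2*i), s (2*i+1)} = {k,a}" using i(2) by (auto simp: a_def)
      have "s (2*i) \<noteq> s (2*i+1)" using sn i(1) by (auto simp: normal_perms_def)
      then have "a \<noteq> k" using i(2) by (auto simp: a_def)
      have mem: "{k,a} \<in> matching n s" using i(1) pair by (auto simp: matching_def)
      then have "a \<noteq> l" using s by (auto simp: S_def)
      have "?\<sigma> ` {k,a} \<in> matching n s" using mem fix_s by blast
      then have "{l,a} \<in> matching n s" using \<open>a \<noteq> k\<close> \<open>a \<noteq> l\<close> by simp
      then obtain j where j: "j < n" "{s (2*j), s (2*j+1)} = {l,a}" by (auto simp: matching_def)
      have "i = j" using perm_pair_disjoint[OF perm[OF sn], of a i j] pair j(2) by auto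
      then have "{k,a} = {l,a}" using pair j(2) by simp
      then show False using kl(3) \<open>a \<noteq> k\<close> by (auto simp: doubleton_eq_iff)
    qed
  qed
  finally show ?thesis .
qed

text \<open>Row and column \<open>k\<close> change together, with zero on the diagonal, so that an
  alternating \<open>A\<close> stays alternating.\<close>

definition replace_line :: "nat \<Rightarrow> (nat \<Rightarrow> 'a) \<Rightarrow> (nat \<Rightarrow> nat \<Rightarrow> 'a) \<Rightarrow> nat \<Rightarrow> nat \<Rightarrow> 'a::comm_ring_1" where
  "replace_line k y A a b =
    (if a = k then (if b = k then 0 else y b) else if b = k then - y a else A a b)"

text \<open>The index \<open>k\<close> occurs in exactly one pair, so a single factor involves
  \<open>y\<close>. That \<open>K\<close> and \<open>p\<close> precede the quantifier over
  \<open>y\<close> is what yields linearity.\<close>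

lemma pf_term_replace_line:
  assumes s: "s permutes {..<2*n}" and k: "k < 2*n"
  shows "\<exists>K p. p < 2*n \<and> (\<forall>y. pf_term n (replace_line k y A) s = K * y p)"
proof -
  obtain i where i: "i < n" "s (2*i) = k \<or> s (2*i+1) = k" using matching_cover[OF s k] .
  have ne: "s (2*i) \<noteq> s (2*i+1)" using inj_eq[OF permutes_inj[OF s]] by simp
  let ?P = "\<Prod>j\<in>{..<n}-{i}. A (s (2*j)) (s (2*j+1))"
  have off: "s (2*j) \<noteq> k \<and> s (2*j+1) \<noteq> k" if "j \<noteq> i" for j
    using perm_pair_disjoint[OF s, of k i j] i(2) that by auto
  have lt: "s (2*i) < 2*n" "s (2*i+1) < 2*n" using permutes_in_image[OF s] i(1) by auto
  have 1: "pf_term n (replace_line k y A) s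
      = signof s * (replace_line k y A (s (2*i)) (s (2*i+1)) * ?P)" for y
  proof -
    have "(\<Prod>j<n. replace_line k y A (s (2*j)) (s (2*j+1)))
        = replace_line k y A (s (2*i)) (s (2*i+1)) * (\<Prod>j\<in>{..<n}-{i}. replace_line k y A (s (2*j)) (s (2*j+1)))"
      by (rule prod.remove) (use i in auto)
    also have "(\<Prod>j\<in>{..<n}-{i}. replace_line k y A (s (2*j)) (s (2*j+1))) = ?P"
      by (rule prod.cong[OF refl]) (use off in \<open>auto simp: replace_line_def\<close>)
    finally show ?thesis by (simp add: pf_term_def)
  qed
  show ?thesis
  proof (cases "s (2*i) = k")
    case True
    show ?thesis
      by (rule exI[of _ "signof s * ?P"], rule exI[of _ "s (2*i+1)"])
        (use True ne lt in \<open>auto simp: 1 replace_line_def mult_ac\<close>)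
  next
    case False
    then show ?thesis
      by (intro exI[of _ "- (signof s * ?P)"] exI[of _ "s (2*i)"])
        (use i(2) ne lt in \<open>auto simp: 1 replace_line_def mult_ac\<close>)
  qed
qed

lemma pf_replace_line:
  assumes k: "k < 2*n"
  shows "pf n (replace_line k y A) = (\<Sum>j<2*n. y j * pf n (replace_line k (ev j) A))"
proof -
  have "pf_term n (replace_line k y A) s = (\<Sum>j<2*n. y j * pf_term n (replace_line k (ev j) A) s)"
    if "s \<in> normal_perms n" for s
  proof -
    have s: "s permutes {..<2*n}" using that by (simp add: normal_perms_def)
    obtain K p where K: "p < 2*n" "\<And>y. pf_term n (replace_line k y A) s = K * y p"
      using pf_term_replace_line[OF s k, of A] by blast
    show ?thesis
      unfolding K(2) by (subst ev_expand[OF K(1), of y]) (simp add: sum_distrib_left mult_ac)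
  qed
  then show ?thesis
    by (simp add: pf_def sum_distrib_left sum.swap[of _ "normal_perms n"])
qed

text \<open>The matrix of the \<open>pf n (replace_line k (ev j) A)\<close> plays the role of the adjugate.\<close>

lemma pf_expansion:
  assumes A: "alt_fun A" and kl: "k < 2*n" "l < 2*n"
  shows "(\<Sum>j<2*n. A l j * pf n (replace_line k (ev j) A)) = (if l = k then pf n A else 0)"
proof (cases "l = k")
  case True
  have "replace_line k (A k) A = A"
  proof (intro ext)
    fix a b
    show "replace_line k (A k) A a b = A a b"
      using alt_fun_diag[OF A, of k] alt_fun_skew[OF A, of a k] by (simp add: replace_line_def)
  qed
  then show ?thesis using pf_replace_line[OF kl(1), of "A k" A] True by simp
next
  case False
  note A0 = alt_fun_diag[OF A] and A1 = alt_fun_skew[OF A]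
  \<comment> \<open>Line \<open>k\<close> is now a copy of line \<open>l\<close>, so swapping both
    changes nothing, and the entry at \<open>(k,l)\<close> is \<open>A l l = 0\<close>.\<close>
  have "pf n (replace_line k (A l) A) = 0"
  proof (rule pf_eq_zero[OF _ kl])
    show "alt_fun (replace_line k (A l) A)"
    proof -
      have "replace_line k (A l) A a b = - replace_line k (A l) A b a" for a b
        using A1[of a b] by (simp add: replace_line_def)
      moreover have "replace_line k (A l) A a a = 0" for a
        by (simp add: replace_line_def A0)
      ultimately show ?thesis unfolding alt_fun_def by blast
    qed
    show "replace_line k (A l) A k l = 0" by (simp add: replace_line_def A0)
    show "replace_line k (A l) A (transpose k l x) (transpose k l y) = replace_line k (A l) A x y" for x y
      using False A0 A1[of x l] by (auto simp: replace_line_def transpose_def)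
  qed (use False in simp)
  then show ?thesis using pf_replace_line[OF kl(1), of "A l" A] False by simp
qed

subsection \<open>Inverses of alternating matrices\<close>

lemma alternating_entries:
  assumes "\<phi> \<in> carrier_mat N N" "alternating \<phi>" "i < N" "j < N"
  shows "\<phi> $$ (i,i) = 0" "\<phi> $$ (i,j) = - \<phi> $$ (j,i)"
  using assms by (auto simp: alternating_def)

lemma pfaffian_right_inverse:
  fixes \<phi> :: "'a::comm_ring_1 mat"
  assumes \<phi>: "\<phi> \<in> carrier_mat (2*n) (2*n)" and alt: "alternating \<phi>" and pf1: "pfaffian \<phi> = 1"
  shows "\<exists>B\<in>carrier_mat (2*n) (2*n). \<phi> * B = 1\<^sub>m (2*n)"
proof -
  define A where "A i j = (if i < 2*n \<and> j < 2*n then \<phi> $$ (i,j) else 0)" for i j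
  have A: "alt_fun A"
    unfolding alt_fun_def
  proof (intro conjI allI)
    fix i j
    show "A i i = 0" using alternating_entries(1)[OF \<phi> alt] by (simp add: A_def)
    show "A i j = - A j i" using alternating_entries(2)[OF \<phi> alt, of i j] by (simp add: A_def)
  qed
  have "pf n A = pfaffian \<phi>"
  proof -
    have "pf_term n A s = signof s * (\<Prod>i<n. \<phi> $$ (s (2*i), s (2*i+1)))" if "s \<in> normal_perms n" for s
    proof -
      have "s x < 2*n" if "x < 2*n" for x
        using permutes_in_image[of s "{..<2*n}" x] that \<open>s \<in> normal_perms n\<close> by (simp add: normal_perms_def)
      then show ?thesis unfolding pf_term_def A_def by (intro arg_cong2[of _ _ _ _ "(*)"] prod.cong) auto
    qed
    then show ?thesis using \<phi> by (simp add: pf_def pfaffian_def normal_perms_def)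
  qed
  with pf1 have pfA: "pf n A = 1" by simp
  \<comment> \<open>By \<open>pf_expansion\<close>, \<open>\<phi> * B\<close> is the Pfaffian times
    the identity.\<close>
  define B where "B = mat (2*n) (2*n) (\<lambda>(j,k). pf n (replace_line k (ev j) A))"
  have "\<phi> * B = 1\<^sub>m (2*n)"
  proof (rule eq_matI)
    fix l k assume "l < dim_row (1\<^sub>m (2*n) :: 'a mat)" "k < dim_col (1\<^sub>m (2*n) :: 'a mat)"
    then have lk: "l < 2*n" "k < 2*n" by auto
    have "(\<phi> * B) $$ (l,k) = (\<Sum>j<2*n. A l j * pf n (replace_line k (ev j) A))"
      using \<phi> lk by (simp add: B_def scalar_prod_def lessThan_atLeast0 A_def)
    then show "(\<phi> * B) $$ (l,k) = 1\<^sub>m (2*n) $$ (l,k)"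
      using pf_expansion[OF A lk(2,1)] lk by (simp add: pfA)
  qed (use \<phi> in \<open>auto simp: B_def\<close>)
  then show ?thesis by (intro bexI[of _ B]) (auto simp: B_def)
qed

text \<open>Transposing \<open>\<phi> * B = I\<close> gives the left inverse
  \<open>- transpose_mat B\<close>, which must equal \<open>B\<close>. So \<open>B\<close> is
  skew-symmetric; its zero diagonal takes more, since skew-symmetry only gives twice the
  entry.\<close>

lemma alternating_inverse:
  assumes \<phi>: "\<phi> \<in> carrier_mat N N" and alt: "alternating \<phi>"
    and ex: "\<exists>B\<in>carrier_mat N N. \<phi> * B = 1\<^sub>m N"
  shows "mat_inverse \<phi> \<in> carrier_mat N N" "\<phi> * mat_inverse \<phi> = 1\<^sub>m N" "mat_inverse \<phi> * \<phi> = 1\<^sub>m N"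
    "\<And>i j. i < N \<Longrightarrow> j < N \<Longrightarrow> mat_inverse \<phi> $$ (i,j) = - mat_inverse \<phi> $$ (j,i)"
    "\<And>i. i < N \<Longrightarrow> mat_inverse \<phi> $$ (i,i) = 0"
proof -
  obtain B where B: "B \<in> carrier_mat N N" "\<phi> * B = 1\<^sub>m N" using ex by blast
  define L where "L = - transpose_mat B"
  have L: "L \<in> carrier_mat N N" using B by (simp add: L_def)
  have tr: "transpose_mat \<phi> = - \<phi>"
  proof (rule eq_matI)
    fix i j assume "i < dim_row (- \<phi>)" "j < dim_col (- \<phi>)"
    then show "transpose_mat \<phi> $$ (i,j) = (- \<phi>) $$ (i,j)"
      using \<phi> alternating_entries(2)[OF \<phi> alt, of i j] by simp
  qed (use \<phi> in auto)
  have "transpose_mat B * transpose_mat \<phi> = 1\<^sub>m N"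
    using transpose_mult[OF \<phi> B(1)] B(2) by simp
  then have L\<phi>: "L * \<phi> = 1\<^sub>m N"
    using \<phi> B(1) by (simp add: tr L_def)
  have uniq: "X = L" if "X \<in> carrier_mat N N" "\<phi> * X = 1\<^sub>m N" for X
  proof -
    have "L * \<phi> * X = L * (\<phi> * X)" using L \<phi> that by (intro assoc_mult_mat)
    then show ?thesis using that L by (simp add: L\<phi>)
  qed
  have BL: "B = L" using uniq B by simp
  have "mat_inverse \<phi> = L"
    unfolding mat_inverse_def
  proof (rule the_equality)
    show "L \<in> carrier_mat (dim_row \<phi>) (dim_row \<phi>) \<and> \<phi> * L = 1\<^sub>m (dim_row \<phi>)"
      using \<phi> L B(2) unfolding BL by auto
  qed (use \<phi> in \<open>auto intro: uniq\<close>)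
  with BL have inv: "mat_inverse \<phi> = B" by simp
  show "mat_inverse \<phi> \<in> carrier_mat N N" "\<phi> * mat_inverse \<phi> = 1\<^sub>m N" "mat_inverse \<phi> * \<phi> = 1\<^sub>m N"
    using B L\<phi> BL by (simp_all add: inv)
  have skew: "B $$ (i,j) = - B $$ (j,i)" if "i < N" "j < N" for i j
    using arg_cong[OF BL, of "\<lambda>M. M $$ (i,j)"] that B(1) by (simp add: L_def)
  show "mat_inverse \<phi> $$ (i,j) = - mat_inverse \<phi> $$ (j,i)" if "i < N" "j < N" for i j
    unfolding inv using that by (rule skew)
  obtain \<nu> where \<nu>: "\<nu> \<in> carrier_mat N N" "\<phi> = \<nu> - transpose_mat \<nu>"
    using alt \<phi> by (auto simp: alternating_def)
  show "mat_inverse \<phi> $$ (i,i) = 0" if i: "i < N" for i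
  proof -
    \<comment> \<open>Thus a diagonal entry of \<open>B\<close> is, up to sign, the alternating form
      \<open>\<phi>\<close> evaluated twice at row \<open>i\<close> of \<open>B\<close>. Writing
      \<open>\<phi>\<close> through \<open>\<nu>\<close> turns it into two sums that agree after
      exchanging \<open>p\<close> and \<open>q\<close>.\<close>
    have "B * \<phi> * B = B" using L\<phi> BL B by simp
    then have "B $$ (i,i) = (B * \<phi> * B) $$ (i,i)" by simp
    also have "\<dots> = (\<Sum>q<N. (\<Sum>p<N. B $$ (i,p) * \<phi> $$ (p,q)) * B $$ (q,i))"
      using i B(1) \<phi> by (simp add: scalar_prod_def lessThan_atLeast0 del: assoc_mult_mat)
    also have "\<dots> = (\<Sum>q<N. \<Sum>p<N. B $$ (i,p) * B $$ (i,q) * \<nu> $$ (q,p) - B $$ (i,p) * B $$ (i,q) * \<nu> $$ (p,q))"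
    proof (intro sum.cong refl)
      fix q assume "q \<in> {..<N}"
      then show "(\<Sum>p<N. B $$ (i,p) * \<phi> $$ (p,q)) * B $$ (q,i) =
          (\<Sum>p<N. B $$ (i,p) * B $$ (i,q) * \<nu> $$ (q,p) - B $$ (i,p) * B $$ (i,q) * \<nu> $$ (p,q))"
        using \<nu>(1) skew[of q i] i unfolding sum_distrib_right
        by (intro sum.cong refl) (simp add: \<nu>(2) algebra_simps)
    qed
    also have "\<dots> = (\<Sum>q<N. \<Sum>p<N. B $$ (i,p) * B $$ (i,q) * \<nu> $$ (q,p))
        - (\<Sum>q<N. \<Sum>p<N. B $$ (i,p) * B $$ (i,q) * \<nu> $$ (p,q))"
      by (simp add: sum_subtractf)
    also have "\<dots> = 0"
      by (subst (2) sum.swap) (simp add: mult_ac)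
    finally show ?thesis by (simp add: inv)
  qed
qed

subsection \<open>The groups \<open>E_phi\<close>\<close>

lemma alpha_phi_tv:
  assumes "dim_row \<phi> = Suc m" "dim_row (mat_inverse \<phi>) = Suc m"
  shows "alpha_phi \<phi> v =
    tv m (\<lambda>i. mat_inverse \<phi> $$ (0, Suc i)) (\<lambda>j. \<Sum>k<m. v $ k * \<phi> $$ (Suc k, Suc j))"
  by (rule eq_matI)
    (simp_all add: assms alpha_phi_def Let_def tv_def blk_d_def blk_lr_def scalar_prod_def
      mat_of_cols_def mat_of_rows_def lessThan_atLeast0 sum_distrib_left mult.assoc)

lemma beta_phi_tv:
  assumes "dim_row \<phi> = Suc m" "dim_row (mat_inverse \<phi>) = Suc m"
  shows "beta_phi \<phi> v =
    tv m (\<lambda>i. \<Sum>k<m. mat_inverse \<phi> $$ (Suc i, Suc k) * v $ k) (\<lambda>j. - \<phi> $$ (0, Suc j))"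
  by (rule eq_matI)
    (simp_all add: assms beta_phi_def Let_def tv_def blk_c_def blk_lr_def scalar_prod_def
      mat_of_cols_def mat_of_rows_def lessThan_atLeast0)

theorem theorem5p1:
  fixes \<phi> :: "'a::comm_ring_1 mat" and n :: nat
  assumes "n \<ge> 2"
    and "\<phi> \<in> carrier_mat (2*n) (2*n)"
    and "alternating \<phi>"
    and "pfaffian \<phi> = 1"
  shows "E_group (2*n - 1) = E_phi \<phi>"
proof -
  define m where "m = 2*n - 1"
  have m: "m \<ge> 3" and n: "2*n = Suc m" using assms(1) by (auto simp: m_def)
  define B where "B = mat_inverse \<phi>"
  have \<phi>: "\<phi> \<in> carrier_mat (Suc m) (Suc m)" using assms(2) by (simp only: n)
  note inv = alternating_inverse[OF \<phi> assms(3) pfaffian_right_inverse[OF assms(2-4), unfolded n], folded B_def]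
  define c d where "c j = - \<phi> $$ (0, Suc j)" and "d j = B $$ (0, Suc j)" for j
  define N M where "N i j = \<phi> $$ (Suc i, Suc j)" and "M i j = B $$ (Suc i, Suc j)" for i j
  define \<alpha> \<beta> where "\<alpha> v = tv m d (\<lambda>j. \<Sum>k<m. v $ k * N k j)"
    and "\<beta> v = tv m (\<lambda>i. \<Sum>k<m. M i k * v $ k) c" for v
  have dims: "dim_row \<phi> = Suc m" "dim_row (mat_inverse \<phi>) = Suc m" "dim_row B = Suc m"
    using \<phi> inv(1) by (auto simp: B_def)
  have \<alpha>: "alpha_phi \<phi> = \<alpha>" "beta_phi \<phi> = \<beta>"
    by (simp_all add: fun_eq_iff alpha_phi_tv[OF dims(1,2)] beta_phi_tv[OF dims(1,2)]
        \<alpha>_def \<beta>_def c_def[abs_def] d_def[abs_def] N_def M_def B_def)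
  define S where "S = {\<alpha> v | v. v \<in> carrier_vec m} \<union> {\<beta> v | v. v \<in> carrier_vec m}"
  have E\<phi>: "E_phi \<phi> = gen_subgroup m S"
    by (simp add: E_phi_def Let_def \<alpha> S_def dims)
  have entry: "(X * Y) $$ (i,j) = X $$ (i,0) * Y $$ (0,j) + (\<Sum>k<m. X $$ (i, Suc k) * Y $$ (Suc k, j))"
    if "X \<in> carrier_mat (Suc m) (Suc m)" "Y \<in> carrier_mat (Suc m) (Suc m)" "i < Suc m" "j < Suc m"
    for X Y :: "'a mat" and i j
    using that by (simp add: scalar_prod_def atLeast0LessThan sum.lessThan_Suc_shift
        del: sum.lessThan_Suc sum.op_ivl_Suc)
  have \<phi>0: "\<phi> $$ (0,0) = 0" using alternating_entries(1)[OF \<phi> assms(3), of 0 0] by simp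
  have B0: "B $$ (0,0) = 0" using inv(5)[of 0] by simp
  have Bs: "B $$ (Suc k, 0) = - d k" if "k < m" for k
    using inv(4)[of "Suc k" 0] that by (simp add: d_def)
  \<comment> \<open>Block equations: \<open>\<phi> * B = I\<close> gives \<open>c d = 1\<close>,
    \<open>N d = 0\<close> and \<open>c M = 0\<close>, while \<open>B * \<phi> = I\<close> gives
    \<open>d c + M N = I\<close> with \<open>d\<close> as a column and \<open>c\<close> as a
    row.\<close>
  have cd: "dot m c d = 1"
    using arg_cong[OF inv(2), of "\<lambda>X. X $$ (0,0)"] entry[OF \<phi> inv(1), of 0 0]
    by (simp add: \<phi>0 Bs dot_def c_def)
  have Nd: "(\<Sum>j<m. N k j * d j) = 0" if "k < m" for k
    using arg_cong[OF inv(2), of "\<lambda>X. X $$ (Suc k,0)"] entry[OF \<phi> inv(1), of "Suc k" 0] that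
    by (simp add: B0 Bs N_def sum_negf)
  have cM: "(\<Sum>j<m. c j * M j k) = 0" if "k < m" for k
    using arg_cong[OF inv(2), of "\<lambda>X. X $$ (0, Suc k)"] entry[OF \<phi> inv(1), of 0 "Suc k"] that
    by (simp add: \<phi>0 M_def c_def sum_negf)
  have MN: "d i * c j + (\<Sum>k<m. M i k * N k j) = (if i = j then 1 else 0)" if "i < m" "j < m" for i j
    using arg_cong[OF inv(3), of "\<lambda>X. X $$ (Suc i, Suc j)"] entry[OF inv(1) \<phi>, of "Suc i" "Suc j"] that
    by (simp add: Bs M_def N_def c_def)
  have \<alpha>_orth: "dot m (\<lambda>j. \<Sum>k<m. v k * N k j) d = 0" for v
  proof -
    have "dot m (\<lambda>j. v k * N k j) d = 0" if "k < m" for k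
      using Nd[OF that] by (simp add: dot_def)
    then show ?thesis by simp
  qed
  have \<beta>_orth: "dot m c (\<lambda>i. \<Sum>k<m. M i k * v k) = 0" for v
  proof -
    have "dot m c (\<lambda>i. M i k * v k) = 0" if "k < m" for k
      using cM[OF that] by (simp add: dot_def sum_distrib_right[symmetric] flip: mult.assoc)
    then show ?thesis by simp
  qed
  interpret transvection_pair m S c d
  proof
    show "m \<ge> 3" "dot m c d = 1" by fact+
  next
    fix w assume w: "dot m w d = 0"
    \<comment> \<open>From \<open>w d = 0\<close> and \<open>I = d c + M N\<close> follows
      \<open>w = (w M) N\<close>, so \<open>v = w M\<close>.\<close>
    define v where "v = vec m (\<lambda>k. \<Sum>i<m. w i * M i k)"
    have "w j = (\<Sum>k<m. v $ k * N k j)" if j: "j < m" for j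
    proof -
      have "w j = (\<Sum>i<m. w i * ev i j)" by (rule ev_expand[OF j])
      also have "\<dots> = (\<Sum>i<m. w i * (d i * c j + (\<Sum>k<m. M i k * N k j)))"
        by (rule sum.cong) (simp_all add: MN[OF _ j] ev_def)
      also have "\<dots> = dot m w d * c j + (\<Sum>i<m. \<Sum>k<m. w i * M i k * N k j)"
        by (simp add: dot_def distrib_left sum.distrib sum_distrib_left sum_distrib_right mult.assoc)
      also have "\<dots> = (\<Sum>k<m. v $ k * N k j)"
        unfolding w by (subst sum.swap) (simp add: v_def sum_distrib_right)
      finally show ?thesis .
    qed
    then have "tv m d w = \<alpha> v" unfolding \<alpha>_def by (intro tv_cong) auto
    moreover have "v \<in> carrier_vec m" by (simp add: v_def)
    ultimately show "tv m d w \<in> gen_subgroup m S"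
      by (intro gen_gen) (auto simp: S_def \<alpha>_def)
  next
    fix u assume u: "dot m c u = 0"
    \<comment> \<open>Likewise \<open>c u = 0\<close> gives \<open>u = M (N u)\<close>, so
      \<open>v = N u\<close>.\<close>
    define v where "v = vec m (\<lambda>k. \<Sum>j<m. N k j * u j)"
    have "u i = (\<Sum>k<m. M i k * v $ k)" if i: "i < m" for i
    proof -
      have "u i = (\<Sum>j<m. u j * ev j i)" by (rule ev_expand[OF i])
      also have "\<dots> = (\<Sum>j<m. (d i * c j + (\<Sum>k<m. M i k * N k j)) * u j)"
        by (rule sum.cong) (simp_all add: MN[OF i] ev_def)
      also have "\<dots> = d i * dot m c u + (\<Sum>j<m. \<Sum>k<m. M i k * (N k j * u j))"
        by (simp add: dot_def distrib_right sum.distrib sum_distrib_left sum_distrib_right mult.assoc)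
      also have "\<dots> = (\<Sum>k<m. M i k * v $ k)"
        unfolding u by (subst sum.swap) (simp add: v_def sum_distrib_left)
      finally show ?thesis .
    qed
    then have "tv m u c = \<beta> v" unfolding \<beta>_def by (intro tv_cong) auto
    moreover have "v \<in> carrier_vec m" by (simp add: v_def)
    ultimately show "tv m u c \<in> gen_subgroup m S"
      by (intro gen_gen) (auto simp: S_def \<beta>_def)
  qed
  have "gen_subgroup m S \<subseteq> E_group m"
    unfolding E_group_def
  proof (rule gen_subgroup_least)
    fix A assume "A \<in> S"
    then obtain v where "A = \<alpha> v \<or> A = \<beta> v" by (auto simp: S_def)
    moreover have "\<alpha> v \<in> E_group m" unfolding \<alpha>_def
      by (rule unimodular_tv_mem_E_group(1)[OF m cd \<alpha>_orth])
    \<comment> \<open>Here \<open>c\<close> is the unimodular vector and \<open>d\<close> its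
      witness, the reverse of the case of \<open>\<alpha>\<close>.\<close>
    moreover have "\<beta> v \<in> E_group m" unfolding \<beta>_def
      by (rule unimodular_tv_mem_E_group(2)[OF m cd[unfolded dot_commute[of m c]]])
        (simp only: dot_commute[of m _ c] \<beta>_orth)
    ultimately show "A \<in> gen_subgroup m {elem_mat m i j a |i j a. i < m \<and> j < m \<and> i \<noteq> j}"
      by (auto simp: E_group_def)
  qed
  with E_group_subset show ?thesis unfolding E\<phi> m_def[symmetric] by blast
qed

end
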